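(* Let $d\geq 2$ and $n\geq 1$ be integers. A subset $M\subset[n]^d$ is non-basic if and only if there exists a non-trivial (i.e. not identically zero) annihilation function of $M$.
   Context: Notation: $[n]=\{1,\ldots,n\}$. A finite subset $M\subset\mathbb{R}^d$ (in particular, a subset $M\subset[n]^d$) is called basic if for any function $f\colon M\to\mathbb{R}$ there exist functions $f_1,\ldots,f_d\colon\mathbb{R}\to\mathbb{R}$ such that $f(x_1,\ldots,x_d)=f_1(x_1)+\ldots+f_d(x_d)$ for every $(x_1,\ldots,x_d)\in M$; otherwise it is non-basic. A layer of $[n]^d$ is a hyperplane given by an equation $x_i=j$ with $i\in[d]$, $j\in[n]$. An annihilation function of $M\subset[n]^d$ is a function $f\colon M\to\mathbb{Z}$ such that $\sum_{x\in L\cap M} f(x)=0$ for each layer $L$. *)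

theory Defs
  imports "HOL-Analysis.Analysis"
begin

definition grid :: "nat \<Rightarrow> (real ^ 'd) set" where
  "grid n = {x. \<forall>i. \<exists>j\<in>{1..n}. x $ i = real j}"

lemma finite_grid: "finite (grid n :: (real ^ 'd) set)"
proof -
  have "(grid n :: (real ^ 'd) set) \<subseteq> vec_lambda ` Pi\<^sub>E UNIV (\<lambda>_. real ` {1..n})"
  proof
    fix x :: "real ^ 'd" assume "x \<in> grid n"
    then have "vec_nth x \<in> Pi\<^sub>E UNIV (\<lambda>_. real ` {1..n})"
      by (auto simp: grid_def PiE_def)
    then show "x \<in> vec_lambda ` Pi\<^sub>E UNIV (\<lambda>_. real ` {1..n})"
      by (metis image_eqI vec_nth_inverse)
  qed
  then show ?thesis
    by (rule finite_subset) (intro finite_imageI finite_PiE, auto)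
qed

(* A function on M is represented by a total function of which only the
   values on M are used, both here and in annihilation_function.
   The notion is meant for finite M. *)
definition basic :: "(real ^ 'd) set \<Rightarrow> bool" where
  "basic M \<longleftrightarrow>
     (\<forall>f :: real ^ 'd \<Rightarrow> real. \<exists>g :: 'd \<Rightarrow> real \<Rightarrow> real.
        \<forall>x\<in>M. f x = (\<Sum>i\<in>UNIV. g i (x $ i)))"

abbreviation non_basic :: "(real ^ 'd) set \<Rightarrow> bool" where
  "non_basic M \<equiv> \<not> basic M"

definition layers :: "nat \<Rightarrow> (real ^ 'd) set set" where
  "layers n = {{x. x $ i = real j} | i j. j \<in> {1..n}}"

(* Meant for M contained in grid n, so that L \<inter> M is finite. *)
definition annihilation_function ::
  "nat \<Rightarrow> (real ^ 'd) set \<Rightarrow> (real ^ 'd \<Rightarrow> int) \<Rightarrow> bool" where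
  "annihilation_function n M f \<longleftrightarrow> (\<forall>L\<in>layers n. (\<Sum>x\<in>L \<inter> M. f x) = 0)"

end

theory Submission
  imports Defs
begin

text \<open>
  Being basic is a statement about real coefficients, while annihilation functions take integer
  values; the equivalence holds because a linear system with integer coefficients is solvable for
  all right-hand sides exactly when its rows admit no nontrivial \<^emph>\<open>integer\<close> relation.

  On \<open>M\<close> only the values \<open>g i (real j)\<close> with \<open>j \<in> {1..n}\<close> of the one-variable functions matter, so
  \<open>M\<close> is basic iff every function on \<open>M\<close> is a real linear combination of the indicator functions
  of the layers (lemma \<open>basic_iff_layer_indicators_span\<close>). The indicators are the columns of a
  0-1 matrix with rows indexed by \<open>M\<close>, and an annihilation function is precisely an integer relation
  between these rows. The alternative for integer matrices
  (lemma \<open>integer_fredholm_alternative\<close>) finishes the proof: a relation \<open>h\<close> is orthogonal to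
  all columns, so \<open>h\<close> itself is not in their span unless it vanishes; conversely, fraction-free
  Gaussian elimination either yields an integer relation or solves the system.
\<close>

text \<open>
  Elimination of one row \<open>x0\<close> at a time. With a pivot \<open>a = u k0 x0 \<noteq> 0\<close> every other row is replaced
  by \<open>a\<close> times itself minus \<open>u k0 x\<close> times the row of \<open>x0\<close>. No division occurs, so the entries
  remain integers, and both a relation and a solution for the reduced rows lift back.
\<close>

lemma integer_relation_or_solvable:
  fixes u :: "'k \<Rightarrow> 'a \<Rightarrow> int"
  assumes "finite X" and "finite K"
  shows "(\<exists>h :: 'a \<Rightarrow> int. (\<forall>k\<in>K. (\<Sum>x\<in>X. h x * u k x) = 0) \<and> (\<exists>x\<in>X. h x \<noteq> 0)) \<or>
    (\<forall>f :: 'a \<Rightarrow> real. \<exists>c :: 'k \<Rightarrow> real. \<forall>x\<in>X. f x = (\<Sum>k\<in>K. c k * of_int (u k x)))"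
  using assms(1)
proof (induction X arbitrary: u rule: finite_induct)
  case empty
  then show ?case by simp
next
  case (insert x0 X)
  show ?case
  proof (cases "\<forall>k\<in>K. u k x0 = 0")
    case True
    have "(\<Sum>x\<in>insert x0 X. of_bool (x = x0) * u k x) = 0" if "k \<in> K" for k
      using True that by (intro sum.neutral) auto
    then show ?thesis
      by (intro disjI1 exI[of _ "\<lambda>x. of_bool (x = x0)"]) auto
  next
    case False
    then obtain k0 where k0: "k0 \<in> K" "u k0 x0 \<noteq> 0" by auto
    define a where "a = u k0 x0"
    have a: "a \<noteq> 0" using k0 by (simp add: a_def)
    define v where "v k x = a * u k x - u k0 x * u k x0" for k x
    from insert.IH[of v] show ?thesis
    proof
      assume "\<exists>h :: 'a \<Rightarrow> int. (\<forall>k\<in>K. (\<Sum>x\<in>X. h x * v k x) = 0) \<and> (\<exists>x\<in>X. h x \<noteq> 0)"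
      then obtain h :: "'a \<Rightarrow> int" and y where h: "\<And>k. k \<in> K \<Longrightarrow> (\<Sum>x\<in>X. h x * v k x) = 0"
        and y: "y \<in> X" "h y \<noteq> 0" by auto
      define h' where "h' x = (if x = x0 then - (\<Sum>z\<in>X. h z * u k0 z) else a * h x)" for x
      have "(\<Sum>x\<in>insert x0 X. h' x * u k x) = 0" if "k \<in> K" for k
      proof -
        have "(\<Sum>x\<in>X. h' x * u k x) = (\<Sum>x\<in>X. a * h x * u k x)"
          using insert.hyps by (intro sum.cong) (auto simp: h'_def)
        then have "(\<Sum>x\<in>insert x0 X. h' x * u k x)
            = (\<Sum>x\<in>X. a * h x * u k x) - (\<Sum>x\<in>X. h x * u k0 x) * u k x0"
          using insert.hyps by (simp add: h'_def)
        also have "\<dots> = (\<Sum>x\<in>X. h x * v k x)"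
          by (simp add: v_def right_diff_distrib sum_subtractf sum_distrib_left mult_ac)
        finally show ?thesis using h[OF that] by simp
      qed
      moreover have "h' y \<noteq> 0"
        using y a insert.hyps by (auto simp: h'_def)
      ultimately show ?thesis using y by blast
    next
      assume solvable: "\<forall>f :: 'a \<Rightarrow> real. \<exists>c :: 'k \<Rightarrow> real. \<forall>x\<in>X.
        f x = (\<Sum>k\<in>K. c k * of_int (v k x))"
      have "\<exists>c :: 'k \<Rightarrow> real. \<forall>x\<in>insert x0 X. f x = (\<Sum>k\<in>K. c k * of_int (u k x))"
        for f :: "'a \<Rightarrow> real"
      proof -
        obtain c :: "'k \<Rightarrow> real" where c: "\<And>x. x \<in> X \<Longrightarrow>
            of_int a * f x - of_int (u k0 x) * f x0 = (\<Sum>k\<in>K. c k * of_int (v k x))"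
          using solvable[rule_format, of "\<lambda>x. of_int a * f x - of_int (u k0 x) * f x0"] by auto
        define S where "S x = (\<Sum>k\<in>K. c k * of_int (u k x))" for x
        \<comment> \<open>The column of the pivot vanishes in \<open>v\<close>, so its coefficient may be corrected freely;
          this choice makes the equation at \<open>x0\<close> hold.\<close>
        define t where "t = (f x0 - S x0) / of_int a"
        define c' where "c' k = c k + (if k = k0 then t else 0)" for k
        have c': "(\<Sum>k\<in>K. c' k * of_int (u k x)) = S x + t * of_int (u k0 x)" for x
        proof -
          have "(\<Sum>k\<in>K. c' k * of_int (u k x))
              = (\<Sum>k\<in>K. c k * of_int (u k x) + (if k0 = k then t * of_int (u k x) else 0))"
            by (intro sum.cong) (auto simp: c'_def distrib_right)
          then show ?thesis
            using k0 assms(2) by (simp add: S_def sum.distrib)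
        qed
        have ta: "of_int a * t = f x0 - S x0"
          using a by (simp add: t_def)
        have "f x = S x + t * of_int (u k0 x)" if "x \<in> insert x0 X" for x
        proof (cases "x = x0")
          case True
          then show ?thesis using ta by (simp add: a_def mult.commute)
        next
          case False
          with that have "of_int a * f x - of_int (u k0 x) * f x0
              = of_int a * S x - of_int (u k0 x) * S x0"
            using c[of x]
            by (simp add: v_def S_def sum_distrib_left sum_subtractf[symmetric] algebra_simps)
          then have "of_int a * f x = of_int a * S x + of_int (u k0 x) * (of_int a * t)"
            unfolding ta by (simp add: algebra_simps)
          then have "of_int a * f x = of_int a * (S x + t * of_int (u k0 x))"
            by (simp add: algebra_simps)
          then show ?thesis using a by simp
        qed
        with c' show ?thesis by (intro exI[of _ c']) auto
      qed
      then show ?thesis by blast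
    qed
  qed
qed

lemma integer_fredholm_alternative:
  fixes u :: "'k \<Rightarrow> 'a \<Rightarrow> int"
  assumes "finite X" and "finite K"
  shows "(\<forall>f :: 'a \<Rightarrow> real. \<exists>c :: 'k \<Rightarrow> real. \<forall>x\<in>X. f x = (\<Sum>k\<in>K. c k * of_int (u k x))) \<longleftrightarrow>
    \<not> (\<exists>h :: 'a \<Rightarrow> int. (\<forall>k\<in>K. (\<Sum>x\<in>X. h x * u k x) = 0) \<and> (\<exists>x\<in>X. h x \<noteq> 0))"
    (is "?solvable \<longleftrightarrow> \<not> ?relation")
proof
  assume ?solvable
  show "\<not> ?relation"
  proof
    assume ?relation
    then obtain h :: "'a \<Rightarrow> int" and y where h: "\<And>k. k \<in> K \<Longrightarrow> (\<Sum>x\<in>X. h x * u k x) = 0"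
      and y: "y \<in> X" "h y \<noteq> 0" by auto
    obtain c :: "'k \<Rightarrow> real" where c: "\<And>x. x \<in> X \<Longrightarrow> of_int (h x) = (\<Sum>k\<in>K. c k * of_int (u k x))"
      using \<open>?solvable\<close>[rule_format, of "\<lambda>x. of_int (h x)"] by auto
    \<comment> \<open>\<open>h\<close> would lie in the span of the columns and be orthogonal to it, hence to itself.\<close>
    have "(\<Sum>x\<in>X. (of_int (h x) :: real)\<^sup>2) = (\<Sum>x\<in>X. \<Sum>k\<in>K. c k * of_int (h x * u k x))"
    proof (rule sum.cong[OF refl])
      fix x assume "x \<in> X"
      have "(of_int (h x) :: real)\<^sup>2 = of_int (h x) * (\<Sum>k\<in>K. c k * of_int (u k x))"
        using c[OF \<open>x \<in> X\<close>] by (simp add: power2_eq_square)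
      then show "(of_int (h x) :: real)\<^sup>2 = (\<Sum>k\<in>K. c k * of_int (h x * u k x))"
        by (simp add: sum_distrib_left mult.left_commute)
    qed
    also have "\<dots> = (\<Sum>k\<in>K. \<Sum>x\<in>X. c k * of_int (h x * u k x))"
      by (rule sum.swap)
    also have "\<dots> = (\<Sum>k\<in>K. c k * of_int (\<Sum>x\<in>X. h x * u k x))"
      by (simp add: sum_distrib_left)
    also have "\<dots> = 0"
      using h by simp
    finally have "\<forall>x\<in>X. (of_int (h x) :: real)\<^sup>2 = 0"
      using assms(1) by (subst (asm) sum_nonneg_eq_0_iff) auto
    with y show False by simp
  qed
next
  assume "\<not> ?relation"
  with integer_relation_or_solvable[OF assms, of u] show ?solvable by blast
qed

lemma basic_iff_layer_indicators_span:
  fixes M :: "(real ^ 'd) set"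
  assumes "M \<subseteq> grid n"
  shows "basic M \<longleftrightarrow> (\<forall>f :: real ^ 'd \<Rightarrow> real. \<exists>c :: 'd \<times> nat \<Rightarrow> real. \<forall>x\<in>M.
    f x = (\<Sum>k\<in>UNIV \<times> {1..n}. c k * of_int (of_bool (x $ fst k = real (snd k)))))"
proof -
  have combination: "(\<Sum>k\<in>UNIV \<times> {1..n}. c k * of_int (of_bool (x $ fst k = real (snd k))))
      = (\<Sum>i\<in>UNIV. \<Sum>j\<in>{1..n}. c (i, j) * of_bool (x $ i = real j))"
    for c :: "'d \<times> nat \<Rightarrow> real" and x :: "real ^ 'd"
    unfolding sum.cartesian_product by (intro sum.cong) auto
  show ?thesis
    unfolding basic_def combination
  proof (intro iff_allI iffI; elim exE)
    fix f :: "real ^ 'd \<Rightarrow> real" and g :: "'d \<Rightarrow> real \<Rightarrow> real"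
    assume g: "\<forall>x\<in>M. f x = (\<Sum>i\<in>UNIV. g i (x $ i))"
    have "(\<Sum>j\<in>{1..n}. g i (real j) * of_bool (x $ i = real j)) = g i (x $ i)"
      if "x \<in> M" for x i
    proof -
      have "x \<in> grid n" using assms that by auto
      then obtain m where m: "m \<in> {1..n}" "x $ i = real m"
        unfolding grid_def by blast
      have "(\<Sum>j\<in>{1..n}. g i (real j) * of_bool (x $ i = real j))
          = (\<Sum>j\<in>{1..n}. if m = j then g i (real j) else 0)"
        by (intro sum.cong) (auto simp: m)
      also have "\<dots> = g i (x $ i)"
        using m by (simp add: sum.delta)
      finally show ?thesis .
    qed
    then show "\<exists>c. \<forall>x\<in>M. f x = (\<Sum>i\<in>UNIV. \<Sum>j\<in>{1..n}. c (i, j) * of_bool (x $ i = real j))"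
      using g by (intro exI[of _ "\<lambda>(i, j). g i (real j)"]) simp
  next
    fix f :: "real ^ 'd \<Rightarrow> real" and c :: "'d \<times> nat \<Rightarrow> real"
    assume "\<forall>x\<in>M. f x = (\<Sum>i\<in>UNIV. \<Sum>j\<in>{1..n}. c (i, j) * of_bool (x $ i = real j))"
    then show "\<exists>g. \<forall>x\<in>M. f x = (\<Sum>i\<in>UNIV. g i (x $ i))"
      by (intro exI[of _ "\<lambda>i t. \<Sum>j\<in>{1..n}. c (i, j) * of_bool (t = real j)"])
  qed
qed

lemma annihilation_function_iff_integer_relation:
  fixes M :: "(real ^ 'd) set"
  assumes "finite M"
  shows "annihilation_function n M f \<longleftrightarrow>
    (\<forall>k\<in>UNIV \<times> {1..n}. (\<Sum>x\<in>M. f x * of_bool (x $ fst k = real (snd k))) = 0)"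
proof -
  have "(\<Sum>x\<in>{x. x $ i = real j} \<inter> M. f x) = (\<Sum>x\<in>M. f x * of_bool (x $ i = real j))" for i j
  proof -
    have "(\<Sum>x\<in>{x. x $ i = real j} \<inter> M. f x) = (\<Sum>x\<in>M \<inter> {x. x $ i = real j}. f x)"
      by (simp add: Int_commute)
    also have "\<dots> = (\<Sum>x\<in>M. if x \<in> {x. x $ i = real j} then f x else 0)"
      using assms by (rule sum.inter_restrict)
    also have "\<dots> = (\<Sum>x\<in>M. f x * of_bool (x $ i = real j))"
      by (intro sum.cong) auto
    finally show ?thesis .
  qed
  then show ?thesis
    unfolding annihilation_function_def layers_def by (auto simp del: sum_mult_of_bool_eq) metis
qed

theorem lemma1p5:
  fixes n :: nat and M :: "(real ^ 'd) set"
  assumes "CARD('d) \<ge> 2" and "n \<ge> 1" and "M \<subseteq> grid n"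
  shows "non_basic M \<longleftrightarrow>
    (\<exists>f :: real ^ 'd \<Rightarrow> int. annihilation_function n M f \<and> (\<exists>x\<in>M. f x \<noteq> 0))"
proof -
  have "finite M"
    using assms(3) finite_grid by (rule finite_subset)
  moreover have "finite (UNIV \<times> {1..n} :: ('d \<times> nat) set)"
    by simp
  ultimately show ?thesis
    unfolding basic_iff_layer_indicators_span[OF assms(3)]
      annihilation_function_iff_integer_relation[OF \<open>finite M\<close>]
    by (subst integer_fredholm_alternative) auto
qed

end
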